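(* Let $f,g_1,\ldots,g_s \in \mathbb{R}[\mathbf{x}]=\mathbb{R}[x_1,\ldots,x_n]$, let $N\in\mathbb{N}$, and let $l_1,\ldots,l_{2n}$ denote the $2n$ linear polynomials $N+x_i,\ N-x_i$ ($i=1,\ldots,n$). Let $K$ be the compact basic closed semi-algebraic set $$K=\{\mathbf{x}\in\mathbb{R}^n : g_i(\mathbf{x})\ge 0 \text{ for } i=1,\ldots,s \text{ and } l_j(\mathbf{x})\ge 0 \text{ for } j=1,\ldots,2n\}.$$ For $q\in\mathbb{N}^*$ let $$R_q(K)=\left\{\prod_{k=1}^q h_k : h_k\in\{1,g_1,\ldots,g_s,l_1,\ldots,l_{2n}\}\right\},\qquad \rho_q=|R_q(K)|.$$ If $f(\mathbf{x})>0$ for all $\mathbf{x}\in K$, then there exist $d,q\in\mathbb{N}^*$, SONC polynomials $s_j(\mathbf{x})\in C_{n,2d}$ and polynomials $H_j(\mathbf{x})\in R_q(K)$, indexed by $j=1,\ldots,\rho_q$, such that $$f(\mathbf{x})=\sum_{j=1}^{\rho_q}s_j(\mathbf{x})H_j(\mathbf{x}).$$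
   Context: Notation: $\mathbb{N}^*=\mathbb{N}\setminus\{0\}$; $n\in\mathbb{N}^*$. $\Delta_{n,2d}$ is the simplex with vertices $\mathbf{0},2d\,\mathbf{e}_1,\ldots,2d\,\mathbf{e}_n$ and $\mathcal{L}_{n,2d}=\Delta_{n,2d}\cap\mathbb{Z}^n$. $V(A)$ denotes the set of vertices of $\operatorname{conv}(A)$. A lattice point is even if it lies in $(2\mathbb{N})^n$. Circuit polynomials: Let $A\subset\mathbb{N}^n$ be finite with all elements of $V(A)$ even. A polynomial $f$ supported on $A$ is a circuit polynomial if $f(\mathbf{x})=\sum_{j=0}^r f_{\boldsymbol{\alpha}(j)}\mathbf{x}^{\boldsymbol{\alpha}(j)}+f_{\boldsymbol{\beta}}\mathbf{x}^{\boldsymbol{\beta}}$ with $r\le n$, $\boldsymbol{\alpha}(j),\boldsymbol{\beta}\in A$, $f_{\boldsymbol{\alpha}(j)}>0$, $f_{\boldsymbol{\beta}}\in\mathbb{R}$, such that (C1) $\boldsymbol{\alpha}(0),\ldots,\boldsymbol{\alpha}(r)$ are affinely independent and form $V(A)$; (C2) $\boldsymbol{\beta}=\sum_{j=0}^r\lambda_j\boldsymbol{\alpha}(j)$ with (unique) $\lambda_j>0$, $\sum_j\lambda_j=1$. $\operatorname{Circ}_A$ is the set of circuit polynomials with support $A$. SONC cone: $P_{n,2d}$ is the cone of polynomials in $n$ variables of degree at most $2d$ that are nonnegative on $\mathbb{R}^n$, and $C_{n,2d}=\{\sum_{i=1}^k\mu_ip_i : k\in\mathbb{N}^*,\ \mu_i\ge0,\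 p_i\in\operatorname{Circ}_{A}\cap P_{n,2d} \text{ for some } A\subseteq\mathcal{L}_{n,2d}\text{ (depending on } i)\}$. Its elements are called SONC polynomials (sums of nonnegative circuit polynomials). Any compact basic closed semi-algebraic set $\{g_i\ge 0\}$ can be put in the form above by choosing $N$ so large that it is contained in $[-N,N]^n$; the constraints $l_j\ge0$ are then redundant. *)

theory Defs
  imports "HOL-Analysis.Analysis" "HOL-Library.Poly_Mapping"
begin

text \<open>
  The polynomial ring over the reals in \<open>CARD('n)\<close> variables: finitely supported maps from
  exponents to coefficients, with the convolution product of \<^theory>\<open>HOL-Library.Poly_Mapping\<close>.
  The variables are indexed by a finite type \<open>'n\<close>, so the number of variables is arbitrary
  and at least one.
\<close>

type_synonym 'n mpoly = "('n \<Rightarrow>\<^sub>0 nat) \<Rightarrow>\<^sub>0 real"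

definition Const :: "real \<Rightarrow> 'n mpoly" where
  "Const c = Poly_Mapping.single 0 c"

definition Var :: "'n \<Rightarrow> 'n mpoly" where
  "Var i = Poly_Mapping.single (Poly_Mapping.single i 1) 1"

definition peval :: "('n::finite) mpoly \<Rightarrow> real ^ 'n \<Rightarrow> real" where
  "peval p x = (\<Sum>m\<in>Poly_Mapping.keys p.
      Poly_Mapping.lookup p m * (\<Prod>i\<in>UNIV. (x $ i) ^ Poly_Mapping.lookup m i))"

definition total_degree_le :: "('n::finite) mpoly \<Rightarrow> nat \<Rightarrow> bool" where
  "total_degree_le p D \<longleftrightarrow>
    (\<forall>m\<in>Poly_Mapping.keys p. (\<Sum>i\<in>UNIV. Poly_Mapping.lookup m i) \<le> D)"

definition exp_point :: "('n::finite \<Rightarrow>\<^sub>0 nat) \<Rightarrow> real ^ 'n" where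
  "exp_point m = (\<chi> i. real (Poly_Mapping.lookup m i))"

definition vertices :: "(real ^ 'n::finite) set \<Rightarrow> (real ^ 'n) set" where
  "vertices S = {v. v extreme_point_of (convex hull S)}"

definition even_point :: "real ^ 'n::finite \<Rightarrow> bool" where
  "even_point v \<longleftrightarrow> (\<forall>i. \<exists>k::nat. v $ i = 2 * real k)"

definition Delta :: "nat \<Rightarrow> (real ^ 'n::finite) set" where
  "Delta D = convex hull (insert 0 (range (\<lambda>i. axis i (real D))))"

definition lattice_simplex :: "nat \<Rightarrow> (real ^ 'n::finite) set" where
  "lattice_simplex D = Delta D \<inter> {v. \<forall>i. v $ i \<in> \<int>}"

text \<open>
  Circuit polynomials supported on \<open>A\<close>. The coefficient \<open>b\<close> of the inner exponent \<open>\<beta>\<close> is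
  any real number, zero included, and for \<open>r = 0\<close> the exponent \<open>\<beta>\<close> coincides with \<open>\<alpha> 0\<close>;
  so \<open>A\<close> need not equal the set of exponents with nonzero coefficient. The family
  \<open>\<alpha> 0, \<dots>, \<alpha> r\<close> is affinely independent as a family, hence the injectivity. The weights \<open>w\<close>
  are then unique.
\<close>

definition Circ :: "('n::finite \<Rightarrow>\<^sub>0 nat) set \<Rightarrow> 'n mpoly set" where
  "Circ A = {f. finite A \<and> (\<forall>v\<in>vertices (exp_point ` A). even_point v) \<and>
     Poly_Mapping.keys f \<subseteq> A \<and>
     (\<exists>(r::nat) (\<alpha>::nat \<Rightarrow> ('n \<Rightarrow>\<^sub>0 nat)) \<beta> (c::nat \<Rightarrow> real) (b::real).
        r \<le> CARD('n) \<and> (\<forall>j\<le>r. \<alpha> j \<in> A) \<and> \<beta> \<in> A \<and> (\<forall>j\<le>r. c j > 0) \<and>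
        f = (\<Sum>j\<le>r. Poly_Mapping.single (\<alpha> j) (c j)) + Poly_Mapping.single \<beta> b \<and>
        inj_on \<alpha> {..r} \<and>
        \<not> affine_dependent ((\<lambda>j. exp_point (\<alpha> j)) ` {..r}) \<and>
        (\<lambda>j. exp_point (\<alpha> j)) ` {..r} = vertices (exp_point ` A) \<and>
        (\<exists>w::nat \<Rightarrow> real. (\<forall>j\<le>r. w j > 0) \<and> (\<Sum>j\<le>r. w j) = 1 \<and>
           exp_point \<beta> = (\<Sum>j\<le>r. w j *\<^sub>R exp_point (\<alpha> j))))}"

definition nonneg_cone :: "nat \<Rightarrow> ('n::finite) mpoly set" where
  "nonneg_cone D = {p. total_degree_le p D \<and> (\<forall>x. peval p x \<ge> 0)}"

definition SONC :: "nat \<Rightarrow> ('n::finite) mpoly set" where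
  "SONC D = {\<Sum>i=1..k. Const (\<mu> i) * p i | (k::nat) (\<mu>::nat \<Rightarrow> real) (p::nat \<Rightarrow> 'n mpoly).
     k \<ge> 1 \<and> (\<forall>i\<in>{1..k}. \<mu> i \<ge> 0 \<and>
       (\<exists>A. exp_point ` A \<subseteq> lattice_simplex D \<and> p i \<in> Circ A \<inter> nonneg_cone D))}"

definition box_polys :: "nat \<Rightarrow> ('n::finite) mpoly set" where
  "box_polys N = range (\<lambda>i. of_nat N + Var i) \<union> range (\<lambda>i. of_nat N - Var i)"

definition K_set :: "nat \<Rightarrow> (nat \<Rightarrow> ('n::finite) mpoly) \<Rightarrow> nat \<Rightarrow> (real ^ 'n) set" where
  "K_set s g N = {x. (\<forall>i\<in>{1..s}. peval (g i) x \<ge> 0) \<and> (\<forall>l\<in>box_polys N. peval l x \<ge> 0)}"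

text \<open>
  As in the usual abuse of notation, this set depends on the description of the semi-algebraic
  set by \<open>g 1, \<dots>, g s\<close> and \<open>N\<close>, not only on its points.
\<close>

definition R_set :: "nat \<Rightarrow> (nat \<Rightarrow> ('n::finite) mpoly) \<Rightarrow> nat \<Rightarrow> nat \<Rightarrow> 'n mpoly set" where
  "R_set s g N q = {\<Prod>k=1..q. h k | h. \<forall>k\<in>{1..q}. h k \<in> {1} \<union> g ` {1..s} \<union> box_polys N}"

end

theory Submission imports Defs begin

text \<open>
  Nonnegative constants are SONC, so it suffices to write \<open>f\<close> as a combination, with nonnegative
  real coefficients, of products of the constraint polynomials. This is Krivine's Positivstellensatz
  for the preprime \<open>T\<close> generated by the \<open>g i\<close> and the \<open>N \<plusminus> x i\<close>. A polynomial that is positive on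
  the cube \<open>[-N, N]\<^sup>n\<close> lies in \<open>T\<close>, because its Bernstein coefficients of high degree are close to
  its values at the grid points, hence positive. For general \<open>f\<close>, rescale each \<open>g i\<close> to \<open>h i\<close> with
  \<open>\<bar>h i\<bar> < 1\<close> on the cube. The function \<open>y (1 - y)\<^sup>k\<close> is at most \<open>1 / k\<close> for \<open>y\<close> in \<open>[0, 1]\<close> and
  very negative for \<open>y \<le> -\<delta>\<close>, so for suitable \<open>c\<close> and \<open>k\<close> the polynomial
  \<open>f - c (\<Sum>i. h i (1 - h i)\<^sup>k)\<close> is positive on the whole cube. It is therefore in \<open>T\<close>, as are
  \<open>h i\<close> and \<open>1 - h i\<close>.
\<close>


section \<open>Evaluation as a ring homomorphism, and induction over polynomials\<close>

section \<open>Evaluation of polynomials\<close>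

lemma Const_0 [simp]: "Const 0 = 0"
  by (simp add: Const_def)

lemma Const_1 [simp]: "Const 1 = 1"
  by (simp add: Const_def)

lemma Const_add: "Const (a + b) = Const a + Const b"
  by (simp add: Const_def single_add)

lemma Const_mult: "Const (a * b) = Const a * Const b"
  by (simp add: Const_def mult_single)

lemma Const_uminus: "Const (- a) = - Const a"
  by (simp add: Const_def single_uminus)

lemma Const_of_nat: "Const (of_nat k) = of_nat k"
  by (induction k) (simp_all add: Const_add)

lemma Const_prod: "Const (\<Prod>i\<in>A. f i) = (\<Prod>i\<in>A. Const (f i))"
  by (induction A rule: infinite_finite_induct) (simp_all add: Const_mult)

lemma mpoly_eq_sum_single:
  "p = (\<Sum>m\<in>Poly_Mapping.keys p. Poly_Mapping.single m (Poly_Mapping.lookup p m))"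
  by (rule poly_mapping_eqI)
     (auto simp: lookup_sum lookup_single when_def in_keys_iff)

lemma Var_mult_single:
  "Var i * Poly_Mapping.single m c = Poly_Mapping.single (Poly_Mapping.single i 1 + m) c"
  by (simp add: Var_def mult_single)

lemma exponent_induct [case_names zero step]:
  fixes m :: "'n::finite \<Rightarrow>\<^sub>0 nat"
  assumes "P 0" and "\<And>i m. P m \<Longrightarrow> P (Poly_Mapping.single i 1 + m)"
  shows "P m"
proof (induction "\<Sum>i\<in>UNIV. Poly_Mapping.lookup m i" arbitrary: m)
  case 0
  then have "m = 0" by (intro poly_mapping_eqI) auto
  then show ?case using assms(1) by simp
next
  case (Suc k)
  then obtain i where i: "Poly_Mapping.lookup m i > 0"
    by (metis gr0I sum.neutral Zero_not_Suc)
  have m: "m = Poly_Mapping.single i 1 + (m - Poly_Mapping.single i 1)"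
    using i by (intro poly_mapping_eqI) (auto simp: lookup_add lookup_minus lookup_single when_def)
  have "Suc k = (\<Sum>j\<in>UNIV. (1 when i = j) + Poly_Mapping.lookup (m - Poly_Mapping.single i 1) j)"
    unfolding Suc(2) by (subst m) (simp add: lookup_add lookup_single)
  then have "k = (\<Sum>j\<in>UNIV. Poly_Mapping.lookup (m - Poly_Mapping.single i 1) j)"
    by (simp add: sum.distrib when_def)
  then show ?case using Suc(1) assms(2) m by metis
qed

text \<open>A single term arises from a constant by multiplying by one variable at a time, and a
  polynomial is the sum of its terms. This reduces multiplicativity of \<open>peval\<close> to
  constants and variables.\<close>

lemma mpoly_induct [case_names Const Var_mult add]:
  fixes p :: "('n::finite) mpoly"
  assumes "\<And>c. P (Const c)"
    and Var: "\<And>i p. P p \<Longrightarrow> P (Var i * p)"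
    and add: "\<And>p q. P p \<Longrightarrow> P q \<Longrightarrow> P (p + q)"
  shows "P p"
proof -
  have *: "P (Poly_Mapping.single m c)" for m c
  proof (induction m rule: exponent_induct)
    case zero show ?case using assms(1)[of c] by (simp add: Const_def)
  next
    case (step i m) then show ?case using Var[OF step] by (simp add: Var_mult_single)
  qed
  have "finite A \<Longrightarrow> P (\<Sum>m\<in>A. Poly_Mapping.single m (Poly_Mapping.lookup p m))" for A
  proof (induction A rule: finite_induct)
    case empty show ?case using assms(1)[of 0] by simp
  next
    case (insert x F) then show ?case using add * by simp
  qed
  then show ?thesis by (subst mpoly_eq_sum_single) simp
qed

text \<open>Lets polynomials with different supports be evaluated over one common set of
  exponents.\<close>

lemma peval_superset:
  assumes "finite F" "Poly_Mapping.keys p \<subseteq> F"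
  shows "peval p x = (\<Sum>m\<in>F. Poly_Mapping.lookup p m * (\<Prod>i\<in>UNIV. (x $ i) ^ Poly_Mapping.lookup m i))"
  unfolding peval_def using assms by (intro sum.mono_neutral_left) (auto simp: in_keys_iff)

lemma peval_add [simp]: "peval (p + q) x = peval p x + peval q x"
proof -
  let ?F = "Poly_Mapping.keys p \<union> Poly_Mapping.keys q"
  have "Poly_Mapping.keys (p + q) \<subseteq> ?F" by (rule keys_add)
  then show ?thesis
    by (simp add: peval_superset[of ?F] lookup_add sum.distrib distrib_right)
qed

lemma peval_single [simp]:
  "peval (Poly_Mapping.single m c) x = c * (\<Prod>i\<in>UNIV. (x $ i) ^ Poly_Mapping.lookup m i)"
  by (subst peval_superset[of "{m}"]) (auto simp: lookup_single)

lemma peval_0 [simp]: "peval 0 x = 0"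
  by (simp add: peval_def)

lemma peval_sum [simp]: "peval (\<Sum>i\<in>A. f i) x = (\<Sum>i\<in>A. peval (f i) x)"
  by (induction A rule: infinite_finite_induct) simp_all

lemma peval_Const [simp]: "peval (Const c) x = c"
  by (simp add: Const_def)

lemma peval_Var [simp]: "peval (Var i) x = x $ i"
proof -
  have "(\<Prod>j\<in>UNIV. (x $ j) ^ (1 when i = j)) = (\<Prod>j\<in>UNIV. if i = j then x $ j else 1)"
    by (rule prod.cong) (auto simp: when_def)
  then show ?thesis by (simp add: Var_def lookup_single)
qed

lemma peval_mult [simp]: "peval (p * q) x = peval p x * peval q x"
proof (induction p rule: mpoly_induct)
  case (Const c)
  show ?case
    by (subst (1 2) mpoly_eq_sum_single[of q])
       (simp add: sum_distrib_left Const_def mult_single mult.assoc)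
next
  case (Var_mult i p)
  have "peval (Var i * r) x = x $ i * peval r x" for r
    by (subst (1 2) mpoly_eq_sum_single[of r])
       (simp add: sum_distrib_left Var_mult_single lookup_add power_add prod.distrib
          mult.left_commute peval_Var[of i x, unfolded Var_def, simplified])
  then show ?case using Var_mult by (simp add: mult.assoc)
next
  case (add p p') then show ?case by (simp add: distrib_right)
qed

lemma peval_1 [simp]: "peval 1 x = 1"
  using peval_Const[of 1] by simp

lemma peval_of_nat [simp]: "peval (of_nat k) x = real k"
  using peval_Const[of "real k"] by (simp add: Const_of_nat)

lemma peval_uminus [simp]: "peval (- p) x = - peval p x"
  using peval_add[of p "- p" x] by simp

lemma peval_diff [simp]: "peval (p - q) x = peval p x - peval q x"
  using peval_add[of p "- q" x] by simp

lemma peval_power [simp]: "peval (p ^ k) x = peval p x ^ k"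
  by (induction k) simp_all

lemma peval_prod [simp]: "peval (\<Prod>i\<in>A. f i) x = (\<Prod>i\<in>A. peval (f i) x)"
  by (induction A rule: infinite_finite_induct) simp_all

lemma continuous_on_peval: "continuous_on S (peval p)"
  unfolding peval_def by (intro continuous_intros)

section \<open>Preprimes\<close>

text \<open>Unlike in a preordering, squares are not adjoined, so members expand into products of
  generators with constant weights.\<close>

inductive_set preprime :: "('n::finite) mpoly set \<Rightarrow> 'n mpoly set" for G where
  Const: "c \<ge> 0 \<Longrightarrow> Const c \<in> preprime G"
| gen: "p \<in> G \<Longrightarrow> p \<in> preprime G"
| add: "p \<in> preprime G \<Longrightarrow> q \<in> preprime G \<Longrightarrow> p + q \<in> preprime G"
| mult: "p \<in> preprime G \<Longrightarrow> q \<in> preprime G \<Longrightarrow> p * q \<in> preprime G"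

lemma preprime_of_nat: "of_nat k \<in> preprime G"
  using preprime.Const[of "real k" G] by (simp add: Const_of_nat)

lemma preprime_0: "0 \<in> preprime G" and preprime_1: "1 \<in> preprime G"
  using preprime_of_nat[of 0 G] preprime_of_nat[of 1 G] by simp_all

lemma preprime_sum: "(\<And>i. i \<in> A \<Longrightarrow> f i \<in> preprime G) \<Longrightarrow> (\<Sum>i\<in>A. f i) \<in> preprime G"
  by (induction A rule: infinite_finite_induct) (simp_all add: preprime_0 preprime.add)

lemma preprime_prod: "(\<And>i. i \<in> A \<Longrightarrow> f i \<in> preprime G) \<Longrightarrow> (\<Prod>i\<in>A. f i) \<in> preprime G"
  by (induction A rule: infinite_finite_induct) (simp_all add: preprime_1 preprime.mult)

lemma preprime_power: "p \<in> preprime G \<Longrightarrow> p ^ k \<in> preprime G"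
  by (induction k) (simp_all add: preprime_1 preprime.mult)

section \<open>Bernstein expansions in one variable, then tensor products on the cube\<close>

section \<open>Bernstein expansions\<close>

text \<open>Multiply \<open>u ^ m\<close> by \<open>(u + v) ^ (k - m) = 1\<close> and expand. The
  coefficients come from the identity \<open>(k choose a) * (a choose m) = (k choose m) * ((k - m)
  choose (a - m))\<close>.\<close>

lemma power_eq_bernstein_sum:
  fixes u v :: "'n mpoly"
  assumes "u + v = 1" "m \<le> k"
  shows "u ^ m = (\<Sum>a\<le>k. Const (real (a choose m) / real (k choose m)) *
                     (of_nat (k choose a) * u ^ a * v ^ (k - a)))"
proof -
  let ?t = "\<lambda>a. Const (real (a choose m) / real (k choose m)) * (of_nat (k choose a) * u ^ a * v ^ (k - a))"
  have coeff: "Const (real ((i + m) choose m) / real (k choose m)) * of_nat (k choose (i + m))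
      = (of_nat ((k - m) choose i) :: 'n mpoly)" if "i \<le> k - m" for i
  proof -
    have "(k choose (i + m)) * ((i + m) choose m) = (k choose m) * ((k - m) choose i)"
      using choose_mult[of m "i + m" k] that assms(2) by simp
    then have "real (k choose (i + m)) * real ((i + m) choose m) = real (k choose m) * real ((k - m) choose i)"
      by (metis of_nat_mult)
    then have "real ((i + m) choose m) / real (k choose m) * real (k choose (i + m)) = real ((k - m) choose i)"
      using assms(2) by (simp add: field_simps)
    then show ?thesis by (metis Const_mult Const_of_nat)
  qed
  have "u ^ m = u ^ m * (u + v) ^ (k - m)" using assms by simp
  also have "\<dots> = (\<Sum>i\<le>k - m. u ^ m * (of_nat ((k - m) choose i) * u ^ i * v ^ (k - m - i)))"
    by (simp add: binomial_ring sum_distrib_left)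
  also have "\<dots> = (\<Sum>i\<le>k - m. ?t (i + m))"
  proof (rule sum.cong[OF refl], goal_cases)
    case (1 i)
    then have t: "?t (i + m) = of_nat ((k - m) choose i) * (u ^ (i + m) * v ^ (k - (i + m)))"
      using coeff[of i] by (simp add: mult.assoc[symmetric])
    have "k - (i + m) = k - m - i" by simp
    then show ?case unfolding t by (simp only: power_add mult_ac)
  qed
  also have "\<dots> = sum ?t {m..k}"
    using assms(2) by (intro sum.reindex_bij_witness[of _ "\<lambda>a. a - m" "\<lambda>i. i + m"]) auto
  \<comment> \<open>The added terms have \<open>a < m\<close>, hence
    \<open>a choose m = 0\<close>.\<close>
  also have "\<dots> = sum ?t {..k}"
    by (intro sum.mono_neutral_left) (auto simp: binomial_eq_0)
  finally show ?thesis .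
qed

text \<open>The ratio is the product of the factors (a - j) / (k - j) for j < m, each uniformly
  close to a / k when k is large. The induction splits off the last factor and gives half of the
  error to it.\<close>

lemma binomial_ratio_uniform_limit:
  fixes e :: real
  assumes "e > 0"
  shows "\<exists>K. \<forall>k\<ge>K. \<forall>a\<le>k. \<bar>real (a choose m) / real (k choose m) - (real a / real k) ^ m\<bar> \<le> e"
  using assms
proof (induction m arbitrary: e)
  case 0 then show ?case by simp
next
  case (Suc m)
  then obtain K where K: "\<And>k a. k \<ge> K \<Longrightarrow> a \<le> k \<Longrightarrow>
      \<bar>real (a choose m) / real (k choose m) - (real a / real k) ^ m\<bar> \<le> e / 2"
    by (meson half_gt_zero)
  \<comment> \<open>The new factor deviates from a / k by at most m / (k - m), which is at most e /
    2 as soon as \<open>k - m \<ge> J\<close>.\<close>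
  obtain J :: nat where J: "real J \<ge> 2 * real m / e" using real_arch_simple by blast
  have "\<bar>real (a choose Suc m) / real (k choose Suc m) - (real a / real k) ^ Suc m\<bar> \<le> e"
    if k: "k \<ge> max K (m + 1 + J)" and a: "a \<le> k" for a k
  proof -
    define x y x' y' where "x = real (a choose m) / real (k choose m)"
      and "y = real (a - m) / real (k - m)" and "x' = (real a / real k) ^ m" and "y' = real a / real k"
    have km: "k > m" using k by simp
    have eq: "real (n choose Suc m) = real (n choose m) * real (n - m) / real (Suc m)" for n
    proof -
      have "Suc m * (n choose Suc m) = (n - m) * (n choose m)"
      proof (cases n)
        case (Suc n')
        show ?thesis
          unfolding binomial_absorb_comp unfolding Suc by (simp only: Suc_times_binomial diff_Suc_1)
      qed simp
      then have "real (Suc m) * real (n choose Suc m) = real (n - m) * real (n choose m)"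
        by (metis of_nat_mult)
      then show ?thesis by (simp add: field_simps)
    qed
    have xy: "real (a choose Suc m) / real (k choose Suc m) = x * y"
      unfolding eq x_def y_def by (simp add: field_simps del: of_nat_Suc)
    have x: "\<bar>x - x'\<bar> \<le> e / 2" using K[of k a] k a by (simp add: x_def x'_def)
    have "real m * 2 \<le> e * real (k - m)"
    proof -
      have "2 * real m \<le> e * real J" using J Suc.prems by (simp add: field_simps)
      also have "\<dots> \<le> e * real (k - m)" using k Suc.prems by (intro mult_left_mono) auto
      finally show ?thesis by (simp only: mult.commute)
    qed
    then have mk: "real m / real (k - m) \<le> e / 2" using km by (simp add: field_simps)
    have "\<bar>y - y'\<bar> \<le> real m / real (k - m)"
    proof (cases "a \<ge> m")
      case True
      have "y' - y = (real m / real (k - m)) * ((real k - real a) / real k)"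
        using True km by (simp add: y_def y'_def of_nat_diff field_simps)
      moreover have "0 \<le> (real k - real a) / real k" "(real k - real a) / real k \<le> 1"
        using a km by auto
      ultimately show ?thesis
        by (metis abs_mult abs_minus_commute abs_of_nonneg divide_nonneg_nonneg mult_left_le of_nat_0_le_iff)
    next
      \<comment> \<open>The truncated difference \<open>a - m\<close> makes \<open>y\<close> zero,
        so the error is \<open>y'\<close> itself.\<close>
      case False
      then have "\<bar>y - y'\<bar> = real a / real k" by (simp add: y_def y'_def)
      also have "\<dots> \<le> real m / real (k - m)" using False km by (intro frac_le) auto
      finally show ?thesis .
    qed
    then have y: "\<bar>y - y'\<bar> \<le> e / 2" using mk by (rule order_trans)
    have x1: "\<bar>x\<bar> \<le> 1"
      using binomial_right_mono[OF a, of m] km by (simp add: x_def)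
    have y1: "\<bar>y'\<bar> \<le> 1" using a by (auto simp: y'_def divide_le_eq_1)
    have "x * y - x' * y' = x * (y - y') + (x - x') * y'" by (simp add: algebra_simps)
    then have "\<bar>x * y - x' * y'\<bar> \<le> \<bar>x\<bar> * \<bar>y - y'\<bar> + \<bar>x - x'\<bar> * \<bar>y'\<bar>"
      by (metis abs_mult abs_triangle_ineq)
    also have "\<dots> \<le> 1 * (e / 2) + (e / 2) * 1"
      using x y x1 y1 Suc.prems by (intro add_mono mult_mono) auto
    finally show ?thesis by (simp only: xy x'_def y'_def power_Suc2 mult_1 mult_1_right field_sum_of_halves)
  qed
  then show ?case by blast
qed

text \<open>For \<open>N > 0\<close>, the affine coordinate that carries [-N, N] onto [0, 1],
  written as a nonnegative multiple of a box constraint; \<open>vbox\<close> is its complement to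
  1.\<close>

definition ubox :: "nat \<Rightarrow> 'n \<Rightarrow> 'n mpoly" where
  "ubox N i = Const (1 / (2 * real N)) * (of_nat N + Var i)"

definition vbox :: "nat \<Rightarrow> 'n \<Rightarrow> 'n mpoly" where
  "vbox N i = Const (1 / (2 * real N)) * (of_nat N - Var i)"

text \<open>The tensor-product Bernstein basis, of degree k in each variable separately.\<close>

definition bern :: "nat \<Rightarrow> nat \<Rightarrow> ('n::finite \<Rightarrow> nat) \<Rightarrow> 'n mpoly" where
  "bern N k a = (\<Prod>i\<in>UNIV. of_nat (k choose a i) * ubox N i ^ a i * vbox N i ^ (k - a i))"

definition grid :: "nat \<Rightarrow> nat \<Rightarrow> ('n::finite \<Rightarrow> nat) \<Rightarrow> real ^ 'n" where
  "grid N k a = (\<chi> i. 2 * real N * (real (a i) / real k) - real N)"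

text \<open>All large k are demanded, not just one, so that two summands can be expanded in the same
  degree.\<close>

definition bern_approximable :: "nat \<Rightarrow> ('n::finite) mpoly \<Rightarrow> bool" where
  "bern_approximable N p \<longleftrightarrow> (\<forall>e>0. \<exists>K. \<forall>k\<ge>K. \<exists>b.
     p = (\<Sum>a\<in>PiE UNIV (\<lambda>_. {..k}). Const (b a) * bern N k a) \<and>
     (\<forall>a\<in>PiE UNIV (\<lambda>_. {..k}). \<bar>b a - peval p (grid N k a)\<bar> \<le> e))"

definition cube :: "nat \<Rightarrow> (real ^ 'n::finite) set" where
  "cube N = {x. \<forall>i. \<bar>x $ i\<bar> \<le> real N}"

lemma compact_cube: "compact (cube N :: (real ^ 'n::finite) set)"
proof -
  have "cube N = cbox (\<chi> i. - real N) (\<chi> i. real N :: real ^ 'n)"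
    by (auto simp: cube_def mem_box_cart abs_le_iff minus_le_iff)
  then show ?thesis by (simp add: compact_cbox)
qed

lemma ubox_add_vbox:
  assumes "N > 0"
  shows "ubox N i + vbox N i = 1"
proof -
  have "2 * of_nat N = Const (2 * real N)"
    by (simp only: Const_of_nat[symmetric] Const_add[symmetric] mult_2)
  then have "ubox N i + vbox N i = Const (1 / (2 * real N)) * Const (2 * real N)"
    by (simp only: ubox_def vbox_def distrib_left[symmetric] flip: \<open>_ = Const (2 * real N)\<close>) simp
  also have "\<dots> = 1" using assms by (simp add: Const_mult[symmetric])
  finally show ?thesis .
qed

lemma Var_eq_ubox:
  assumes "N > 0"
  shows "Var i = Const (2 * real N) * ubox N i + Const (- real N)"
proof -
  have "Const (2 * real N) * ubox N i = (of_nat N + Var i)"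
    using assms by (simp add: ubox_def mult.assoc[symmetric] Const_mult[symmetric])
  then show ?thesis by (simp add: Const_uminus Const_of_nat)
qed

lemma peval_ubox_grid:
  assumes "N > 0"
  shows "peval (ubox N i) (grid N k a) = real (a i) / real k"
  using assms by (simp add: ubox_def grid_def)

lemma bern_approximable_add:
  assumes "bern_approximable N p" "bern_approximable N q"
  shows "bern_approximable N (p + q)"
  unfolding bern_approximable_def
proof (intro allI impI)
  fix e :: real assume e: "e > 0"
  let ?A = "\<lambda>k. PiE UNIV (\<lambda>_. {..k})"
  have e2: "e / 2 > 0" using e by simp
  obtain K where K: "\<And>k. k \<ge> K \<Longrightarrow> \<exists>b. p = (\<Sum>a\<in>?A k. Const (b a) * bern N k a) \<and>
         (\<forall>a\<in>?A k. \<bar>b a - peval p (grid N k a)\<bar> \<le> e / 2)"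
    using assms(1)[unfolded bern_approximable_def, rule_format, OF e2] by blast
  obtain L where L: "\<And>k. k \<ge> L \<Longrightarrow> \<exists>b. q = (\<Sum>a\<in>?A k. Const (b a) * bern N k a) \<and>
         (\<forall>a\<in>?A k. \<bar>b a - peval q (grid N k a)\<bar> \<le> e / 2)"
    using assms(2)[unfolded bern_approximable_def, rule_format, OF e2] by blast
  have "\<exists>b. p + q = (\<Sum>a\<in>?A k. Const (b a) * bern N k a) \<and>
         (\<forall>a\<in>?A k. \<bar>b a - peval (p + q) (grid N k a)\<bar> \<le> e)" if "k \<ge> max K L" for k
  proof -
    have k: "k \<ge> K" "k \<ge> L" using that by auto
    obtain b c where b: "p = (\<Sum>a\<in>?A k. Const (b a) * bern N k a)"
        "\<And>a. a \<in> ?A k \<Longrightarrow> \<bar>b a - peval p (grid N k a)\<bar> \<le> e / 2"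
      and c: "q = (\<Sum>a\<in>?A k. Const (c a) * bern N k a)"
        "\<And>a. a \<in> ?A k \<Longrightarrow> \<bar>c a - peval q (grid N k a)\<bar> \<le> e / 2"
      using K[OF k(1)] L[OF k(2)] by blast
    have "p + q = (\<Sum>a\<in>?A k. Const (b a + c a) * bern N k a)"
      by (subst b(1), subst c(1)) (simp add: Const_add distrib_right sum.distrib)
    moreover have "\<bar>b a + c a - peval (p + q) (grid N k a)\<bar> \<le> e" if "a \<in> ?A k" for a
      using b(2)[OF that] c(2)[OF that] unfolding peval_add by linarith
    ultimately show ?thesis by (intro exI[of _ "\<lambda>a. b a + c a"]) blast
  qed
  then show "\<exists>K. \<forall>k\<ge>K. \<exists>b. p + q = (\<Sum>a\<in>?A k. Const (b a) * bern N k a) \<and>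
         (\<forall>a\<in>?A k. \<bar>b a - peval (p + q) (grid N k a)\<bar> \<le> e)" by blast
qed

text \<open>Expanding each power separately and multiplying out gives coefficients that are products
  of binomial ratios. All factors lie in [0, 1], so the errors of the factors merely add up.\<close>

lemma bern_approximable_monomial:
  fixes m :: "'n::finite \<Rightarrow> nat"
  assumes N: "N > 0"
  shows "bern_approximable N (Const c * (\<Prod>i\<in>UNIV. ubox N i ^ m i))"
  unfolding bern_approximable_def
proof (intro allI impI)
  fix e :: real assume e: "e > 0"
  let ?A = "\<lambda>k. PiE (UNIV :: 'n set) (\<lambda>_. {..k})"
  let ?p = "Const c * (\<Prod>i\<in>UNIV. ubox N i ^ m i)"
  define \<phi> :: "nat \<Rightarrow> nat \<Rightarrow> 'n \<Rightarrow> real"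
    where "\<phi> = (\<lambda>k a i. real (a choose m i) / real (k choose m i))"
  \<comment> \<open>The tolerance is shared among the variables; the \<open>+ 1\<close> keeps the
    denominator nonzero for \<open>c = 0\<close>.\<close>
  define d where "d = e / ((\<bar>c\<bar> + 1) * real CARD('n))"
  have d: "d > 0" using e by (simp add: d_def)
  have "\<forall>i. \<exists>K. \<forall>k\<ge>K. \<forall>a\<le>k. \<bar>\<phi> k a i - (real a / real k) ^ m i\<bar> \<le> d"
    unfolding \<phi>_def using binomial_ratio_uniform_limit[OF d] by blast
  then obtain K where K: "\<And>i k a. k \<ge> K i \<Longrightarrow> a \<le> k \<Longrightarrow> \<bar>\<phi> k a i - (real a / real k) ^ m i\<bar> \<le> d"
    by metis
  have "\<exists>b. ?p = (\<Sum>a\<in>?A k. Const (b a) * bern N k a) \<and>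
         (\<forall>a\<in>?A k. \<bar>b a - peval ?p (grid N k a)\<bar> \<le> e)" if k: "k \<ge> (\<Sum>i\<in>UNIV. K i + m i)" for k
  proof -
    have km: "K i + m i \<le> k" for i
      using member_le_sum[of i UNIV "\<lambda>i. K i + m i"] k by simp
    let ?b = "\<lambda>a. c * (\<Prod>i\<in>UNIV. \<phi> k (a i) i)"
    have "(\<Prod>i\<in>UNIV. ubox N i ^ m i) = (\<Prod>i\<in>UNIV. \<Sum>a\<le>k. Const (\<phi> k a i) *
        (of_nat (k choose a) * ubox N i ^ a * vbox N i ^ (k - a)))"
      unfolding \<phi>_def using km
      by (intro prod.cong refl power_eq_bernstein_sum ubox_add_vbox[OF N]) (meson add_leE)
    also have "\<dots> = (\<Sum>a\<in>?A k. \<Prod>i\<in>UNIV. Const (\<phi> k (a i) i) *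
        (of_nat (k choose a i) * ubox N i ^ a i * vbox N i ^ (k - a i)))"
      by (rule prod_sum_PiE) auto
    also have "\<dots> = (\<Sum>a\<in>?A k. Const (\<Prod>i\<in>UNIV. \<phi> k (a i) i) * bern N k a)"
      by (simp only: prod.distrib Const_prod bern_def mult_ac)
    finally have "?p = (\<Sum>a\<in>?A k. Const (?b a) * bern N k a)"
      by (simp add: sum_distrib_left Const_mult mult.assoc)
    moreover have "\<bar>?b a - peval ?p (grid N k a)\<bar> \<le> e" if a: "a \<in> ?A k" for a
    proof -
      have ak: "a i \<le> k" for i using a by (auto simp: PiE_iff)
      have "\<bar>(\<Prod>i\<in>UNIV. \<phi> k (a i) i) - (\<Prod>i\<in>UNIV. (real (a i) / real k) ^ m i)\<bar>
          \<le> (\<Sum>i\<in>UNIV. \<bar>\<phi> k (a i) i - (real (a i) / real k) ^ m i\<bar>)"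
      proof (rule norm_prod_diff[where 'a = real, unfolded real_norm_def], goal_cases)
        case (1 i)
        have "m i \<le> k" using km[of i] by simp
        then show ?case using binomial_right_mono[OF ak[of i], of "m i"] by (simp add: \<phi>_def)
      next
        case (2 i)
        have "real (a i) / real k \<le> 1" using ak[of i] by (auto simp: divide_le_eq_1)
        then show ?case by (simp add: power_le_one power_divide[symmetric] del: power_divide)
      qed
      also have "\<dots> \<le> (\<Sum>i\<in>(UNIV::'n set). d)"
        using K ak km by (intro sum_mono) (meson add_leE)
      also have "\<dots> = e / (\<bar>c\<bar> + 1)" by (simp add: d_def)
      finally have *: "\<bar>(\<Prod>i\<in>UNIV. \<phi> k (a i) i) - (\<Prod>i\<in>UNIV. (real (a i) / real k) ^ m i)\<bar> \<le> e / (\<bar>c\<bar> + 1)" .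
      have "\<bar>?b a - peval ?p (grid N k a)\<bar>
          = \<bar>c\<bar> * \<bar>(\<Prod>i\<in>UNIV. \<phi> k (a i) i) - (\<Prod>i\<in>UNIV. (real (a i) / real k) ^ m i)\<bar>"
        by (simp add: peval_ubox_grid[OF N] right_diff_distrib abs_mult[symmetric])
      also have "\<dots> \<le> \<bar>c\<bar> * (e / (\<bar>c\<bar> + 1))" using * by (intro mult_left_mono) auto
      also have "\<dots> \<le> e" using e by (simp add: field_simps)
      finally show ?thesis .
    qed
    ultimately show ?thesis by (intro exI[of _ ?b]) blast
  qed
  then show "\<exists>K. \<forall>k\<ge>K. \<exists>b. ?p = (\<Sum>a\<in>?A k. Const (b a) * bern N k a) \<and>
         (\<forall>a\<in>?A k. \<bar>b a - peval ?p (grid N k a)\<bar> \<le> e)" by blast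
qed

text \<open>Sums of monomials in the rescaled coordinates; its induction rule has exactly the two
  cases already settled for \<open>bern_approximable\<close>.\<close>

inductive_set ubox_span :: "nat \<Rightarrow> ('n::finite) mpoly set" for N where
  monomial: "Const c * (\<Prod>i\<in>UNIV. ubox N i ^ m i) \<in> ubox_span N"
| add: "p \<in> ubox_span N \<Longrightarrow> q \<in> ubox_span N \<Longrightarrow> p + q \<in> ubox_span N"

lemma ubox_span_scale: "p \<in> ubox_span N \<Longrightarrow> Const c * p \<in> ubox_span N"
  by (induction rule: ubox_span.induct)
     (auto simp: mult.assoc[symmetric] Const_mult[symmetric] distrib_left intro: ubox_span.intros)

lemma ubox_span_mult_ubox:
  assumes "p \<in> ubox_span N"
  shows "ubox N i * p \<in> ubox_span N"
  using assms
proof (induction rule: ubox_span.induct)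
  case (monomial c m)
  have "(\<Prod>j\<in>UNIV. ubox N j ^ (m(i := Suc (m i))) j) = ubox N i * (\<Prod>j\<in>UNIV. ubox N j ^ m j)"
  proof -
    have "ubox N j ^ (m(i := Suc (m i))) j = (if j = i then ubox N i else 1) * ubox N j ^ m j" for j
      by simp
    then show ?thesis by (simp only: prod.distrib) simp
  qed
  then have "ubox N i * (Const c * (\<Prod>j\<in>UNIV. ubox N j ^ m j))
      = Const c * (\<Prod>j\<in>UNIV. ubox N j ^ (m(i := Suc (m i))) j)"
    by (simp add: mult.left_commute del: fun_upd_apply)
  then show ?case by (simp only: ubox_span.monomial)
qed (simp add: distrib_left ubox_span.add)

lemma ubox_span_UNIV:
  assumes "N > 0"
  shows "p \<in> ubox_span N"
proof (induction p rule: mpoly_induct)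
  case (Const c)
  show ?case using ubox_span.monomial[of c N "\<lambda>_. 0"] by simp
next
  case (Var_mult i p)
  have "Var i * p = Const (2 * real N) * (ubox N i * p) + Const (- real N) * p"
    by (subst Var_eq_ubox[OF assms]) (simp add: distrib_right mult.assoc)
  then show ?case using Var_mult by (simp add: ubox_span.add ubox_span_scale ubox_span_mult_ubox)
qed (rule ubox_span.add)

lemma bern_approximable:
  assumes "N > 0"
  shows "bern_approximable N p"
  using ubox_span_UNIV[OF assms, of p]
  by (induction rule: ubox_span.induct)
     (rule bern_approximable_monomial[OF assms], rule bern_approximable_add)

text \<open>The case \<open>N = 0\<close>, where the rescaling \<^term>\<open>ubox\<close> to \<open>[0, 1]\<close> divides by zero.\<close>

lemma preprime_of_pos_at_origin:
  assumes G: "box_polys 0 \<subseteq> preprime G" and pos: "peval p 0 > 0"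
  shows "p \<in> preprime G"
proof -
  have mem: "Var i \<in> preprime G" "- Var i \<in> preprime G" for i
  proof -
    have "of_nat 0 + Var i \<in> box_polys 0" "of_nat 0 - Var i \<in> box_polys 0"
      unfolding box_polys_def by blast+
    then show "Var i \<in> preprime G" "- Var i \<in> preprime G"
      using G by (simp_all add: subset_eq)
  qed
  have mon: "Poly_Mapping.single m c \<in> preprime G" if "c \<ge> 0" for m c
    using that
  proof (induction m rule: exponent_induct)
    case zero then show ?case using preprime.Const[of c G] by (simp add: Const_def)
  next
    case (step i m)
    then show ?case
      using preprime.mult[OF mem(1)[of i] step.IH] unfolding Var_mult_single by simp
  qed
  \<comment> \<open>A nonconstant term can absorb a minus sign into one of its variables, since
    \<open>- Var i\<close> is also available. Only the constant coefficient, the value at the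
    origin, is constrained.\<close>
  have mon': "Poly_Mapping.single m c \<in> preprime G" if "m = 0 \<Longrightarrow> c \<ge> 0" for m c
  proof (cases "c \<ge> 0")
    case False
    with that have "m \<noteq> 0" by auto
    then obtain i where i: "Poly_Mapping.lookup m i > 0"
      by (metis gr0I poly_mapping_eqI lookup_zero)
    have m: "Poly_Mapping.single i 1 + (m - Poly_Mapping.single i 1) = m"
      using i by (intro poly_mapping_eqI) (auto simp: lookup_add lookup_minus lookup_single when_def)
    have "- Var i * Poly_Mapping.single (m - Poly_Mapping.single i 1) (- c) \<in> preprime G"
      using False by (intro preprime.mult mem mon) simp
    moreover have "- Var i * Poly_Mapping.single (m - Poly_Mapping.single i 1) (- c) = Poly_Mapping.single m c"
      by (simp add: single_uminus Var_mult_single m del: One_nat_def)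
    ultimately show ?thesis by simp
  qed (rule mon)
  \<comment> \<open>Inserting 0 lets the sum select the constant coefficient without knowing that 0
    is a key.\<close>
  let ?F = "insert 0 (Poly_Mapping.keys p)"
  have "(\<Prod>i\<in>UNIV. ((0::real^'a) $ i) ^ Poly_Mapping.lookup m i) = (if m = 0 then 1 else 0)" for m :: "'a \<Rightarrow>\<^sub>0 nat"
  proof (cases "m = 0")
    case False
    then obtain i where "Poly_Mapping.lookup m i > 0"
      by (metis gr0I poly_mapping_eqI lookup_zero)
    then have "(\<Prod>i\<in>UNIV. ((0::real^'a) $ i) ^ Poly_Mapping.lookup m i) = 0"
      by (intro prod_zero bexI[of _ i]) auto
    then show ?thesis using False by simp
  qed simp
  then have "peval p 0 = (\<Sum>m\<in>?F. Poly_Mapping.lookup p m * (if m = 0 then 1 else 0))"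
    by (subst peval_superset[of ?F]) auto
  also have "\<dots> = (\<Sum>m\<in>?F. if m = 0 then Poly_Mapping.lookup p m else 0)"
    by (intro sum.cong) auto
  finally have "Poly_Mapping.lookup p 0 = peval p 0" by simp
  with pos show ?thesis
    by (subst mpoly_eq_sum_single) (intro preprime_sum mon', auto)
qed

text \<open>The minimum of p on the cube serves as the tolerance: coefficients that close to the
  grid values are nonnegative. The Bernstein basis itself consists of products of box constraints
  and nonnegative constants.\<close>

lemma preprime_of_pos_on_cube:
  assumes G: "box_polys N \<subseteq> preprime G" and pos: "\<And>x. x \<in> cube N \<Longrightarrow> peval p x > 0"
  shows "p \<in> preprime G"
proof (cases "N = 0")
  case True
  then show ?thesis using G pos[of 0] by (intro preprime_of_pos_at_origin) (auto simp: cube_def)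
next
  case False
  then have N: "N > 0" by simp
  have "(0 :: real ^ 'a) \<in> cube N" by (simp add: cube_def)
  then obtain x0 where x0: "x0 \<in> cube N" "\<And>x. x \<in> cube N \<Longrightarrow> peval p x0 \<le> peval p x"
    using continuous_attains_inf[OF compact_cube _ continuous_on_peval] by blast
  obtain K where K: "\<And>k. k \<ge> K \<Longrightarrow> \<exists>b. p = (\<Sum>a\<in>PiE UNIV (\<lambda>_. {..k}). Const (b a) * bern N k a) \<and>
     (\<forall>a\<in>PiE UNIV (\<lambda>_. {..k}). \<bar>b a - peval p (grid N k a)\<bar> \<le> peval p x0)"
    using bern_approximable[OF N, of p] pos[OF x0(1)] unfolding bern_approximable_def by blast
  define k where "k = Suc K"
  obtain b where b: "p = (\<Sum>a\<in>PiE UNIV (\<lambda>_. {..k}). Const (b a) * bern N k a)"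
     "\<And>a. a \<in> PiE UNIV (\<lambda>_. {..k}) \<Longrightarrow> \<bar>b a - peval p (grid N k a)\<bar> \<le> peval p x0"
    using K[of k] by (auto simp: k_def)
  have bern: "bern N k a \<in> preprime G" for a
    using G unfolding bern_def ubox_def vbox_def
    by (intro preprime_prod preprime.mult preprime_power preprime_of_nat preprime.Const)
       (auto simp: box_polys_def)
  have "b a \<ge> 0" if a: "a \<in> PiE UNIV (\<lambda>_. {..k})" for a
  proof -
    have "grid N k a \<in> cube N"
    proof -
      have "0 \<le> real (a i) / real k" "real (a i) / real k \<le> 1" for i
        using a by (auto simp: PiE_iff k_def divide_le_eq_1 simp flip: of_nat_Suc)
      then have "0 \<le> 2 * real N * (real (a i) / real k)" "2 * real N * (real (a i) / real k) \<le> 2 * real N * 1" for i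
        by (simp, intro mult_left_mono) simp_all
      then show ?thesis by (simp add: cube_def grid_def abs_le_iff)
    qed
    then show ?thesis using b(2)[OF a] x0(2)[of "grid N k a"] by linarith
  qed
  then show ?thesis
    by (subst b(1)) (intro preprime_sum preprime.mult preprime.Const bern)
qed

section \<open>A polynomial weight that penalises violated constraints\<close>

section \<open>Reduction to positivity on the cube\<close>

text \<open>For y > 0, Bernoulli bounds n y by (1 + y)^n, and (1 + y)^n (1 - y)^n = (1 - y^2)^n is
  at most 1.\<close>

lemma mult_one_minus_power_le:
  fixes y :: real
  assumes "\<bar>y\<bar> \<le> 1" "n > 0"
  shows "y * (1 - y) ^ n \<le> 1 / real n"
proof (cases "y \<le> 0")
  case True
  then have "y * (1 - y) ^ n \<le> 0" by (intro mult_nonpos_nonneg) auto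
  then show ?thesis by (rule order_trans) simp
next
  case False
  have "real n * y \<le> (1 + y) ^ n"
    using Bernoulli_inequality[of y n] False by simp
  then have "real n * y * (1 - y) ^ n \<le> (1 + y) ^ n * (1 - y) ^ n"
    using assms by (intro mult_right_mono) auto
  also have "\<dots> = (1 - y\<^sup>2) ^ n"
    by (simp add: power_mult_distrib[symmetric] power2_eq_square algebra_simps)
  also have "\<dots> \<le> 1"
    using assms by (intro power_le_one) (auto simp: abs_square_le_1)
  finally show ?thesis using assms(2) by (simp add: field_simps)
qed

text \<open>Since 1 - y is at least 1 + \<delta>, Bernoulli makes the power at least n \<delta>; the
  factor -y supplies the other \<delta>.\<close>

lemma mult_one_minus_power_le_neg:
  fixes y \<delta> :: real
  assumes "y \<le> - \<delta>" "\<delta> \<ge> 0"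
  shows "y * (1 - y) ^ n \<le> - real n * \<delta>\<^sup>2"
proof -
  have "real n * \<delta> \<le> (1 + \<delta>) ^ n"
    using Bernoulli_inequality[of \<delta> n] assms(2) by simp
  also have "\<dots> \<le> (1 - y) ^ n" using assms by (intro power_mono) auto
  finally have "\<delta> * (real n * \<delta>) \<le> (- y) * (1 - y) ^ n"
    using assms by (intro mult_mono) auto
  then show ?thesis by (simp add: power2_eq_square mult_ac)
qed

text \<open>With c proportional to n, the terms bounded by 1 / n cost at most \<eta> / 2 in total,
  while a constraint violated by \<delta> gains a multiple of n^2, which outweighs the lower bound
  -M of f.\<close>

lemma positive_after_subtracting_weights:
  fixes f :: "'a::topological_space \<Rightarrow> real" and h :: "'i \<Rightarrow> 'a \<Rightarrow> real"
  assumes I: "finite I" and D: "compact D"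
    and cont: "continuous_on D f" "\<And>i. i \<in> I \<Longrightarrow> continuous_on D (h i)"
    and h1: "\<And>i x. i \<in> I \<Longrightarrow> x \<in> D \<Longrightarrow> \<bar>h i x\<bar> \<le> 1"
    and pos: "\<And>x. x \<in> D \<Longrightarrow> (\<And>i. i \<in> I \<Longrightarrow> h i x \<ge> 0) \<Longrightarrow> f x > 0"
  shows "\<exists>c\<ge>0. \<exists>n. \<forall>x\<in>D. f x - c * (\<Sum>i\<in>I. h i x * (1 - h i x) ^ n) > 0"
proof (cases "D = {}")
  case False
  \<comment> \<open>A positive minimum of \<open>?\<phi>\<close> gives the alternative: \<open>f x \<ge> \<eta>\<close>, or some \<open>h i x \<le> - \<delta>\<close>.\<close>
  let ?\<phi> = "\<lambda>x. max (f x) (\<Sum>i\<in>I. max 0 (- h i x))"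
  have "continuous_on D ?\<phi>"
    using cont by (intro continuous_intros)
  then obtain z where z: "z \<in> D" "\<And>x. x \<in> D \<Longrightarrow> ?\<phi> z \<le> ?\<phi> x"
    using continuous_attains_inf[OF D False] by blast
  define \<eta> where "\<eta> = ?\<phi> z"
  have \<eta>: "\<eta> > 0"
  proof (cases "\<forall>i\<in>I. h i z \<ge> 0")
    case True then show ?thesis using pos z(1) by (simp add: \<eta>_def less_max_iff_disj)
  next
    case False
    then obtain i where "i \<in> I" "h i z < 0" by auto
    then have "(\<Sum>i\<in>I. max 0 (- h i z)) > 0"
      using I by (intro sum_pos2[of I i]) auto
    then show ?thesis by (simp add: \<eta>_def less_max_iff_disj)
  qed
  obtain z' where z': "z' \<in> D" "\<And>x. x \<in> D \<Longrightarrow> f z' \<le> f x"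
    using continuous_attains_inf[OF D False cont(1)] by blast
  define M where "M = \<bar>f z'\<bar>"
  have M: "f x \<ge> - M" "M \<ge> 0" if "x \<in> D" for x using z'(2)[OF that] by (auto simp: M_def)
  \<comment> \<open>The \<open>+ 1\<close> makes \<open>S\<close> positive for empty
    \<open>I\<close> and makes \<open>card I * \<delta> < \<eta>\<close> strict.\<close>
  define S where "S = real (card I) + 1"
  have S: "S > 0" by (simp add: S_def)
  define \<delta> where "\<delta> = \<eta> / S"
  have \<delta>: "\<delta> > 0" using \<eta> S by (simp add: \<delta>_def)
  have alt: "f x \<ge> \<eta> \<or> (\<exists>i\<in>I. h i x \<le> - \<delta>)" if x: "x \<in> D" for x
  proof (rule ccontr)
    assume "\<not> ?thesis"
    then have fx: "f x < \<eta>" and hx: "\<And>i. i \<in> I \<Longrightarrow> max 0 (- h i x) \<le> \<delta>"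
      using \<delta> by (auto simp: not_le intro: less_imp_le) 
    have "(\<Sum>i\<in>I. max 0 (- h i x)) \<le> real (card I) * \<delta>"
      using sum_bounded_above[of I "\<lambda>i. max 0 (- h i x)" \<delta>] hx by simp
    also have "\<dots> < S * \<delta>" using \<delta> by (simp add: S_def)
    also have "\<dots> = \<eta>" using S by (simp add: \<delta>_def)
    finally have "?\<phi> x < \<eta>" using fx by simp
    then show False using z(2)[OF x] unfolding \<eta>_def by (meson not_less)
  qed
  \<comment> \<open>Chosen so that \<open>c * n * \<delta>\<^sup>2\<close>, which equals
    \<open>\<eta> * n\<^sup>2 * \<delta>\<^sup>2 / (2 * S)\<close>, exceeds
    \<open>M + \<eta>\<close>; here m is bounded by n^2.\<close>
  obtain m :: nat where m: "real m > (M + \<eta>) * (2 * S) / (\<eta> * \<delta>\<^sup>2)"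
    using reals_Archimedean2 by blast
  define n where "n = Suc m"
  define c where "c = \<eta> * real n / (2 * S)"
  have n: "n > 0" and c: "c \<ge> 0" using \<eta> S by (simp_all add: n_def c_def)
  have cS: "c * (S / real n) = \<eta> / 2" using n S by (simp add: c_def field_simps)
  have "f x - c * (\<Sum>i\<in>I. h i x * (1 - h i x) ^ n) > 0" if x: "x \<in> D" for x
  proof -
    have le: "h i x * (1 - h i x) ^ n \<le> 1 / real n" if "i \<in> I" for i
      using mult_one_minus_power_le[OF h1[OF that x] n] .
    have card_le: "real (card J) * (1 / real n) \<le> S / real n" if "J \<subseteq> I" for J
      using card_mono[OF I that] n by (simp add: S_def divide_right_mono)
    from alt[OF x] show ?thesis
    proof
      assume fx: "f x \<ge> \<eta>"
      have "(\<Sum>i\<in>I. h i x * (1 - h i x) ^ n) \<le> real (card I) * (1 / real n)"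
        by (rule sum_bounded_above) (rule le)
      also have "\<dots> \<le> S / real n" by (rule card_le) simp
      finally have "c * (\<Sum>i\<in>I. h i x * (1 - h i x) ^ n) \<le> \<eta> / 2"
        using c cS mult_left_mono by metis
      then show ?thesis using fx \<eta> by linarith
    next
      assume "\<exists>i\<in>I. h i x \<le> - \<delta>"
      then obtain i where i: "i \<in> I" "h i x \<le> - \<delta>" by blast
      have "(\<Sum>j\<in>I - {i}. h j x * (1 - h j x) ^ n) \<le> real (card (I - {i})) * (1 / real n)"
        by (rule sum_bounded_above) (use le in auto)
      also have "\<dots> \<le> S / real n" by (rule card_le) auto
      finally have "(\<Sum>j\<in>I. h j x * (1 - h j x) ^ n) \<le> - real n * \<delta>\<^sup>2 + S / real n"
        using mult_one_minus_power_le_neg[OF i(2), of n] \<delta> by (simp add: sum.remove[OF I i(1)])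
      then have "c * (\<Sum>j\<in>I. h j x * (1 - h j x) ^ n) \<le> c * (- real n * \<delta>\<^sup>2 + S / real n)"
        using c by (rule mult_left_mono)
      also have "\<dots> = - (c * real n * \<delta>\<^sup>2) + \<eta> / 2"
        unfolding distrib_left cS by simp
      finally have *: "c * (\<Sum>j\<in>I. h j x * (1 - h j x) ^ n) \<le> - (c * real n * \<delta>\<^sup>2) + \<eta> / 2" .
      have "(M + \<eta>) * (2 * S) < \<eta> * \<delta>\<^sup>2 * real m"
        using m \<eta> \<delta> by (simp add: pos_divide_less_eq mult_ac)
      also have "\<dots> \<le> \<eta> * \<delta>\<^sup>2 * (real n * real n)"
      proof (rule mult_left_mono)
        have "real m * 1 \<le> real n * real n" by (intro mult_mono) (auto simp: n_def)
        then show "real m \<le> real n * real n" by simp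
      qed (use \<eta> in simp)
      finally have "M + \<eta> < c * real n * \<delta>\<^sup>2"
        using S by (simp add: c_def pos_less_divide_eq mult_ac)
      then show ?thesis using * M(1)[OF x] \<eta> by linarith
    qed
  qed
  then show ?thesis using c by blast
qed auto

lemma preprime_of_pos_on_K_set:
  fixes f :: "('n::finite) mpoly"
  assumes f: "\<forall>x\<in>K_set s g N. peval f x > 0"
  shows "f \<in> preprime (g ` {1..s} \<union> box_polys N)" (is "f \<in> preprime ?G")
proof -
  have K: "x \<in> K_set s g N" if "x \<in> cube N" "\<forall>i\<in>{1..s}. peval (g i) x \<ge> 0" for x
  proof -
    have "\<bar>x $ i\<bar> \<le> real N" for i using that(1) by (simp add: cube_def)
    then have "real N + x $ i \<ge> 0" "real N - x $ i \<ge> 0" for i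
      by (metis abs_le_D2 add.commute diff_ge_0_iff_ge diff_minus_eq_add, metis abs_le_D1 diff_ge_0_iff_ge)
    then show ?thesis using that(2) by (auto simp: K_set_def box_polys_def)
  qed
  have G: "box_polys N \<subseteq> preprime ?G" by (auto intro: preprime.gen)
  have "\<exists>C>0. \<forall>x\<in>cube N. \<bar>peval (g i) x\<bar> < C" for i
  proof -
    have "bounded (peval (g i) ` cube N)"
      by (intro compact_imp_bounded compact_continuous_image continuous_on_peval compact_cube)
    then obtain B where B: "B > 0" "\<forall>y\<in>peval (g i) ` cube N. norm y \<le> B"
      unfolding bounded_pos by blast
    \<comment> \<open>The extra 1 makes the bound strict.\<close>
    then show ?thesis by (intro exI[of _ "B + 1"]) fastforce
  qed
  then obtain C where C: "\<And>i. C i > 0" "\<And>i x. x \<in> cube N \<Longrightarrow> \<bar>peval (g i) x\<bar> < C i"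
    by metis
  define h where "h = (\<lambda>i. Const (1 / C i) * g i)"
  have h1: "\<bar>peval (h i) x\<bar> < 1" if "x \<in> cube N" for i x
    using C(1)[of i] C(2)[OF that, of i] by (simp add: h_def abs_mult)
  have "\<exists>c\<ge>0. \<exists>n. \<forall>x\<in>cube N. peval f x - c * (\<Sum>i\<in>{1..s}. peval (h i) x * (1 - peval (h i) x) ^ n) > 0"
  proof (rule positive_after_subtracting_weights)
    fix x :: "real ^ 'n" assume x: "x \<in> cube N" and h: "\<And>i. i \<in> {1..s} \<Longrightarrow> peval (h i) x \<ge> 0"
    have "peval (g i) x \<ge> 0" if "i \<in> {1..s}" for i
      using h[OF that] C(1)[of i] by (simp add: h_def zero_le_divide_iff)
    then show "peval f x > 0" using f x K by blast
  qed (use h1 in \<open>auto simp: compact_cube continuous_on_peval less_imp_le\<close>)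
  then obtain c n where c: "c \<ge> 0"
    and pos: "\<And>x. x \<in> cube N \<Longrightarrow> peval f x - c * (\<Sum>i\<in>{1..s}. peval (h i) x * (1 - peval (h i) x) ^ n) > 0"
    by blast
  let ?w = "Const c * (\<Sum>i\<in>{1..s}. h i * (1 - h i) ^ n)"
  have "f - ?w \<in> preprime ?G"
    using pos by (intro preprime_of_pos_on_cube[OF G]) simp
  moreover have "h i \<in> preprime ?G" if "i \<in> {1..s}" for i
    unfolding h_def using that C(1)[of i] by (intro preprime.mult preprime.Const preprime.gen) auto
  \<comment> \<open>Strictness in \<open>h1\<close> makes this polynomial positive on the whole
    cube, so the cube case applies to it too.\<close>
  moreover have "1 - h i \<in> preprime ?G" for i
    using h1 by (intro preprime_of_pos_on_cube[OF G]) (simp add: abs_less_iff)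
  ultimately have "(f - ?w) + ?w \<in> preprime ?G"
    using c by (intro preprime.add preprime.mult preprime_sum preprime.Const preprime_power) auto
  then show ?thesis by simp
qed

section \<open>From preprime membership to a certificate with q factors per product\<close>

section \<open>Products of constraints and SONC weights\<close>

text \<open>One coefficient per distinct product, matching the number of terms in the final
  representation.\<close>

definition R_cone :: "nat \<Rightarrow> (nat \<Rightarrow> ('n::finite) mpoly) \<Rightarrow> nat \<Rightarrow> nat \<Rightarrow> 'n mpoly set" where
  "R_cone s g N q =
     {\<Sum>h\<in>R_set s g N q. Const (c h) * h | c. \<forall>h\<in>R_set s g N q. c h \<ge> 0}"

lemma R_set_0: "R_set s g N 0 = {1}"
  by (auto simp: R_set_def)

lemma R_set_Suc:
  "R_set s g N (Suc q) = (\<lambda>(a, b). a * b) ` (R_set s g N q \<times> ({1} \<union> g ` {1..s} \<union> box_polys N))"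
  (is "_ = ?f ` (_ \<times> ?B)")
proof (intro equalityI subsetI)
  fix x assume "x \<in> R_set s g N (Suc q)"
  then obtain h where h: "x = (\<Prod>k=1..Suc q. h k)" "\<forall>k\<in>{1..Suc q}. h k \<in> ?B"
    by (auto simp: R_set_def)
  have "(\<Prod>k=1..q. h k) \<in> R_set s g N q"
    unfolding R_set_def using h(2) by (intro CollectI exI[of _ h]) auto
  moreover have "h (Suc q) \<in> ?B" using h(2) by simp
  moreover have "x = ?f (\<Prod>k=1..q. h k, h (Suc q))" using h(1) by simp
  ultimately show "x \<in> ?f ` (R_set s g N q \<times> ?B)" by blast
next
  fix x assume "x \<in> ?f ` (R_set s g N q \<times> ?B)"
  then obtain h b where h: "x = (\<Prod>k=1..q. h k) * b" "\<forall>k\<in>{1..q}. h k \<in> ?B" "b \<in> ?B"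
    unfolding R_set_def by auto
  have "(\<Prod>k=1..Suc q. (h(Suc q := b)) k) = (\<Prod>k=1..q. h k) * b" by simp
  moreover have "\<forall>k\<in>{1..Suc q}. (h(Suc q := b)) k \<in> ?B" using h by auto
  ultimately show "x \<in> R_set s g N (Suc q)" using h(1) unfolding R_set_def mem_Collect_eq by metis
qed

lemma finite_R_set: "finite (R_set s g N q)"
  by (induction q) (auto simp: R_set_0 R_set_Suc box_polys_def)

lemma R_set_mult:
  assumes "a \<in> R_set s g N q" "b \<in> R_set s g N r"
  shows "a * b \<in> R_set s g N (q + r)"
  using assms(2)
proof (induction r arbitrary: b)
  case 0 then show ?case using assms(1) by (simp add: R_set_0)
next
  case (Suc r)
  then obtain b' t where "b = b' * t" "b' \<in> R_set s g N r" "t \<in> {1} \<union> g ` {1..s} \<union> box_polys N"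
    unfolding R_set_Suc by auto
  then show ?case using Suc.IH[of b'] by (auto simp: R_set_Suc mult.assoc[symmetric])
qed

lemma one_in_R_set: "1 \<in> R_set s g N q"
  unfolding R_set_def by (intro CollectI exI[of _ "\<lambda>_. 1"]) simp

text \<open>Shorter products are padded with factors 1.\<close>

lemma R_set_mono:
  assumes "q \<le> r"
  shows "R_set s g N q \<subseteq> R_set s g N r"
  using R_set_mult[OF _ one_in_R_set[of s g N "r - q"], of _ q] assms by auto

text \<open>Indices that yield the same product are grouped and their weights added, so any finite
  family with repetitions is admissible.\<close>

lemma R_coneI:
  assumes J: "finite J" and w: "\<And>j. j \<in> J \<Longrightarrow> w j \<ge> 0" and t: "\<And>j. j \<in> J \<Longrightarrow> t j \<in> R_set s g N q"
  shows "(\<Sum>j\<in>J. Const (w j) * t j) \<in> R_cone s g N q"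
proof -
  have Const_sum: "Const (\<Sum>j\<in>A. w j) = (\<Sum>j\<in>A. Const (w j))" for A
    by (induction A rule: infinite_finite_induct) (simp_all add: Const_add)
  let ?c = "\<lambda>h. \<Sum>j | j \<in> J \<and> t j = h. w j"
  have "(\<Sum>j\<in>J. Const (w j) * t j)
      = (\<Sum>h\<in>R_set s g N q. \<Sum>j | j \<in> J \<and> t j = h. Const (w j) * t j)"
    using t by (intro sum.group[symmetric] J finite_R_set) auto
  also have "\<dots> = (\<Sum>h\<in>R_set s g N q. Const (?c h) * h)"
    by (intro sum.cong refl) (auto simp: Const_sum sum_distrib_right)
  finally show ?thesis
    unfolding R_cone_def using w by (auto intro!: exI[of _ ?c] sum_nonneg)
qed

lemma R_cone_mono:
  assumes "f \<in> R_cone s g N q" "q \<le> r"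
  shows "f \<in> R_cone s g N r"
  using assms(1) R_set_mono[OF assms(2), of s g N] unfolding R_cone_def[of s g N q]
  by (auto intro!: R_coneI finite_R_set)

lemma R_cone_add:
  assumes "p \<in> R_cone s g N q" "p' \<in> R_cone s g N q"
  shows "p + p' \<in> R_cone s g N q"
proof -
  obtain c c' where "p = (\<Sum>h\<in>R_set s g N q. Const (c h) * h)" "\<forall>h\<in>R_set s g N q. c h \<ge> 0"
    "p' = (\<Sum>h\<in>R_set s g N q. Const (c' h) * h)" "\<forall>h\<in>R_set s g N q. c' h \<ge> 0"
    using assms unfolding R_cone_def by auto
  then have "p + p' = (\<Sum>h\<in>R_set s g N q. Const (c h + c' h) * h)"
      "\<forall>h\<in>R_set s g N q. c h + c' h \<ge> 0"
    by (simp_all add: Const_add distrib_right sum.distrib)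
  then show ?thesis
    unfolding R_cone_def by (intro CollectI exI[of _ "\<lambda>h. c h + c' h"]) blast
qed

lemma R_cone_mult:
  assumes "p \<in> R_cone s g N q" "p' \<in> R_cone s g N r"
  shows "p * p' \<in> R_cone s g N (q + r)"
proof -
  obtain c c' where c: "p = (\<Sum>h\<in>R_set s g N q. Const (c h) * h)" "\<forall>h\<in>R_set s g N q. c h \<ge> 0"
    "p' = (\<Sum>h\<in>R_set s g N r. Const (c' h) * h)" "\<forall>h\<in>R_set s g N r. c' h \<ge> 0"
    using assms unfolding R_cone_def by auto
  have "p * p' = (\<Sum>(h, h')\<in>R_set s g N q \<times> R_set s g N r. (Const (c h) * h) * (Const (c' h') * h'))"
    unfolding c(1,3) sum_product sum.cartesian_product ..
  also have "\<dots> = (\<Sum>j\<in>R_set s g N q \<times> R_set s g N r. Const (c (fst j) * c' (snd j)) * (fst j * snd j))"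
    by (intro sum.cong refl) (auto simp: Const_mult mult_ac)
  also have "\<dots> \<in> R_cone s g N (q + r)"
    using c(2,4) by (intro R_coneI) (auto simp: finite_R_set R_set_mult)
  finally show ?thesis .
qed

text \<open>Sums are brought to a common length by padding to the maximum; in products the lengths
  add.\<close>

lemma preprime_in_R_cone:
  assumes "p \<in> preprime (g ` {1..s} \<union> box_polys N)"
  shows "\<exists>q\<ge>1. p \<in> R_cone s g N q"
  using assms
proof (induction rule: preprime.induct)
  case (Const c)
  then have "Const c \<in> R_cone s g N 1"
    using R_coneI[of "{()}" "\<lambda>_. c" "\<lambda>_. 1" s g N 1] by (simp add: one_in_R_set)
  then show ?case by blast
next
  case (gen p)
  then have "p \<in> R_set s g N 1"
    unfolding R_set_def by (intro CollectI exI[of _ "\<lambda>_. p"]) auto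
  then have "p \<in> R_cone s g N 1"
    using R_coneI[of "{()}" "\<lambda>_. 1" "\<lambda>_. p" s g N 1] by simp
  then show ?case by blast
next
  case (add p p')
  then obtain q r where "q \<ge> 1" "p \<in> R_cone s g N q" "p' \<in> R_cone s g N r" by blast
  then have "p + p' \<in> R_cone s g N (max q r)"
    by (intro R_cone_add) (auto elim: R_cone_mono)
  then show ?case using \<open>q \<ge> 1\<close> by (intro exI[of _ "max q r"]) auto
next
  case (mult p p')
  then obtain q r where "q \<ge> 1" "p \<in> R_cone s g N q" "p' \<in> R_cone s g N r" by blast
  then show ?case by (intro exI[of _ "q + r"]) (auto intro: R_cone_mult)
qed

lemma exp_point_0 [simp]: "exp_point 0 = 0"
  by (simp add: exp_point_def vec_eq_iff)

text \<open>The constant \<open>1\<close> is the degenerate circuit with \<open>r = 0\<close>, \<open>\<beta> = \<alpha> 0 = 0\<close> and inner coefficient \<open>0\<close>.\<close>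

lemma one_in_Circ: "(1 :: ('n::finite) mpoly) \<in> Circ {0}"
proof -
  have v: "vertices {0 :: real ^ 'n} = {0}"
    by (auto simp: vertices_def extreme_point_of_def)
  have even: "even_point (0 :: real ^ 'n)"
    unfolding even_point_def by (intro allI exI[of _ 0]) simp
  have sum: "(1 :: 'n mpoly) = (\<Sum>j\<le>0::nat. Poly_Mapping.single 0 1) + Poly_Mapping.single 0 0"
    by simp
  have weights: "\<exists>w::nat \<Rightarrow> real. (\<forall>j\<le>0. w j > 0) \<and> (\<Sum>j\<le>0. w j) = 1 \<and>
      exp_point (0 :: 'n \<Rightarrow>\<^sub>0 nat) = (\<Sum>j\<le>0. w j *\<^sub>R exp_point 0)"
    by (intro exI[of _ "\<lambda>_. 1"]) simp
  show ?thesis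
    unfolding Circ_def mem_Collect_eq
    by (intro conjI, (use v even in simp_all)[3],
        rule exI[of _ 0], rule exI[of _ "\<lambda>_. 0"], rule exI[of _ 0], rule exI[of _ "\<lambda>_. 1"],
        rule exI[of _ 0], intro conjI)
      (use sum weights v in simp_all)
qed

text \<open>A single summand suffices: c times the circuit polynomial 1, whose support {0} lies in
  every simplex.\<close>

lemma Const_in_SONC:
  assumes "c \<ge> 0"
  shows "Const c \<in> (SONC D :: ('n::finite) mpoly set)"
proof -
  have "(0 :: real ^ 'n) \<in> lattice_simplex D"
    by (auto simp: lattice_simplex_def Delta_def intro: hull_inc)
  moreover have "(1 :: 'n mpoly) \<in> nonneg_cone D"
    by (auto simp: nonneg_cone_def total_degree_le_def)
  ultimately have "\<exists>A. exp_point ` A \<subseteq> lattice_simplex D \<and> (1 :: 'n mpoly) \<in> Circ A \<inter> nonneg_cone D"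
    using one_in_Circ by (intro exI[of _ "{0}"]) auto
  then show ?thesis
    unfolding SONC_def using assms
    by (intro CollectI exI[of _ 1] exI[of _ "\<lambda>_. c"] exI[of _ "\<lambda>_. 1"]) auto
qed

theorem theorem4p8:
  fixes f :: "('n::finite) mpoly" and g :: "nat \<Rightarrow> 'n mpoly" and s N :: nat
  assumes "\<forall>x\<in>K_set s g N. peval f x > 0"
  shows "\<exists>(d::nat) (q::nat) (\<sigma>::nat \<Rightarrow> 'n mpoly) (H::nat \<Rightarrow> 'n mpoly).
           d \<ge> 1 \<and> q \<ge> 1 \<and>
           (\<forall>j\<in>{1..card (R_set s g N q)}. \<sigma> j \<in> SONC (2 * d) \<and> H j \<in> R_set s g N q) \<and>
           f = (\<Sum>j=1..card (R_set s g N q). \<sigma> j * H j)"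
proof -
  obtain q c where q: "q \<ge> 1" and c: "\<forall>h\<in>R_set s g N q. c h \<ge> 0"
    and f: "f = (\<Sum>h\<in>R_set s g N q. Const (c h) * h)"
    using preprime_in_R_cone[OF preprime_of_pos_on_K_set[OF assms]] unfolding R_cone_def by auto
  obtain H where H: "bij_betw H {1..card (R_set s g N q)} (R_set s g N q)"
    using ex_bij_betw_nat_finite_1[OF finite_R_set] by blast
  have "H j \<in> R_set s g N q" if "j \<in> {1..card (R_set s g N q)}" for j
    using bij_betwE[OF H] that by blast
  moreover have "f = (\<Sum>j=1..card (R_set s g N q). Const (c (H j)) * H j)"
    unfolding f by (rule sum.reindex_bij_betw[OF H, symmetric])
  \<comment> \<open>The weights are constants, which are SONC for every degree bound, so
    \<open>d = 1\<close> will do.\<close>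
  ultimately show ?thesis
    using q c by (intro exI[of _ 1] exI[of _ q] exI[of _ "\<lambda>j. Const (c (H j))"] exI[of _ H])
      (auto simp: Const_in_SONC)
qed

end
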